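(* Let $\mathcal{A}$ be a unital Banach algebra, let $n\geq 1$ be an integer, and let $a_0,a_1,\dots,a_n\in\mathcal{A}$ with $a_0$ and $a_n$ invertible. Let $p(z)=a_0+a_1z+\cdots+a_{n-1}z^{n-1}+a_nz^n\in\mathcal{A}[z]$. Let $u\in\mathcal{A}$ be such that $p(u)=0$ and $u$ is invertible. Then $$\|u\|\geq\frac{1}{\max\left\{1,\sum_{j=1}^{n}\|a_0^{-1}a_j\|\right\}}\geq\frac{1}{\max\left\{1,\|a_0^{-1}\|\left(\sum_{j=1}^{n}\|a_j\|\right)\right\}}.$$
   Context: Here $\mathcal{A}$ is a (possibly noncommutative) Banach algebra with unit $1\neq 0$, and $\mathcal{A}[z]$ is the set of polynomials over $\mathcal{A}$. Coefficients are written on the left of the powers of $z$, and $p(u)$ means $p(u)=a_0+a_1u+\cdots+a_nu^n$. *)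

theory Defs
  imports Complex_Main "HOL-Computational_Algebra.Polynomial"
begin

text \<open>
  A unital Banach algebra is a type of sort \<open>{real_normed_algebra, ring_1, banach}\<close>: the norm is
  submultiplicative and complete, and \<open>1 \<noteq> 0\<close>, but neither commutativity nor \<open>norm 1 = 1\<close> is
  required (the latter is what the class \<open>real_normed_algebra_1\<close> would add). Real scalars cover
  complex Banach algebras by restriction of scalars.
\<close>

text \<open>The library's \<open>inverse\<close> and \<open>is_unit\<close> are for division rings and commutative rings.\<close>

definition is_inverse_of :: "'a::monoid_mult \<Rightarrow> 'a \<Rightarrow> bool" where
  "is_inverse_of b a \<longleftrightarrow> a * b = 1 \<and> b * a = 1"

definition invertible_elem :: "'a::monoid_mult \<Rightarrow> bool" where
  "invertible_elem a \<longleftrightarrow> (\<exists>b. is_inverse_of b a)"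

text \<open>Unspecified if the argument is not invertible.\<close>

definition inverse_elem :: "'a::monoid_mult \<Rightarrow> 'a" where
  "inverse_elem a = (THE b. is_inverse_of b a)"

lemma is_inverse_of_unique:
  assumes "is_inverse_of b a" "is_inverse_of c a"
  shows "b = c"
  using assms unfolding is_inverse_of_def by (metis mult.assoc mult_1_left mult_1_right)

lemma inverse_elem_eqI: "is_inverse_of b a \<Longrightarrow> inverse_elem a = b"
  unfolding inverse_elem_def by (blast intro: the_equality is_inverse_of_unique)

lemma is_inverse_of_inverse_elem: "invertible_elem a \<Longrightarrow> is_inverse_of (inverse_elem a) a"
  by (auto simp: invertible_elem_def inverse_elem_eqI)

text \<open>
  The library's \<open>poly\<close> evaluates over commutative semirings only. Here coefficients stand on the
  left of the powers.
\<close>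

definition eval_poly_left :: "'a::semiring_1 poly \<Rightarrow> 'a \<Rightarrow> 'a" where
  "eval_poly_left p u = (\<Sum>j\<le>degree p. coeff p j * u ^ j)"

end

theory Submission
  imports Defs
begin

text \<open>
  Multiplying \<open>p(u) = 0\<close> on the left by the inverse of \<open>a\<^sub>0\<close> isolates the unit as
  \<open>1 = - (b\<^sub>1 u + \<dots> + b\<^sub>n u\<^sup>n)\<close>, where \<open>b\<^sub>j\<close> is the inverse of \<open>a\<^sub>0\<close> times \<open>a\<^sub>j\<close>. When \<open>\<parallel>u\<parallel> \<le> 1\<close>,
  each positive power of \<open>u\<close> has norm at most \<open>\<parallel>u\<parallel>\<close>, so the right-hand side has norm at most
  \<open>(\<parallel>b\<^sub>1\<parallel> + \<dots> + \<parallel>b\<^sub>n\<parallel>) \<parallel>u\<parallel>\<close>, while the unit has norm at least 1; this bounds \<open>\<parallel>u\<parallel>\<close> below by the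
  reciprocal of the sum (\<open>sum_norm_bound_of_unit_combination\<close>). When \<open>\<parallel>u\<parallel> > 1\<close> the term 1 in the
  maximum already gives the bound. The second inequality is submultiplicativity applied
  to each \<open>b\<^sub>j\<close>.
\<close>

text \<open>
  Since \<open>1 = 1 * 1\<close>, submultiplicativity gives \<open>\<parallel>1\<parallel> \<le> \<parallel>1\<parallel>\<^sup>2\<close>, and \<open>\<parallel>1\<parallel>\<close> is positive. This
  inequality stands in for the normalisation \<open>\<parallel>1\<parallel> = 1\<close>, which may fail here.
\<close>

lemma one_le_norm_one: "1 \<le> norm (1::'a::{real_normed_algebra, ring_1})"
  using norm_mult_ineq [of "1::'a" 1] by simp

text \<open>
  The induction starts at exponent 1 because \<open>\<parallel>u\<^sup>0\<parallel> = \<parallel>1\<parallel> \<ge> 1\<close> breaks the bound when \<open>\<parallel>u\<parallel> < 1\<close>.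
\<close>

lemma norm_power_le_norm:
  fixes u :: "'a::{real_normed_algebra, ring_1}"
  assumes "norm u \<le> 1" "j \<ge> 1"
  shows "norm (u ^ j) \<le> norm u"
  using assms(2)
proof (induction j rule: dec_induct)
  case base
  then show ?case by simp
next
  case (step j)
  have "norm (u ^ Suc j) \<le> norm u * norm (u ^ j)"
    by (simp add: norm_mult_ineq)
  also have "\<dots> \<le> 1 * norm (u ^ j)"
    using assms(1) by (intro mult_right_mono) auto
  finally show ?case
    using step.IH by simp
qed

lemma sum_norm_bound_of_unit_combination:
  fixes b :: "nat \<Rightarrow> 'a::{real_normed_algebra, ring_1}"
  assumes "1 + (\<Sum>j=1..n. b j * u ^ j) = 0" "norm u \<le> 1"
  shows "1 \<le> (\<Sum>j=1..n. norm (b j)) * norm u"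
proof -
  have "1 \<le> norm (1::'a)"
    by (rule one_le_norm_one)
  also have "\<dots> = norm (\<Sum>j=1..n. b j * u ^ j)"
    using assms(1) by (metis eq_neg_iff_add_eq_0 norm_minus_cancel)
  also have "\<dots> \<le> (\<Sum>j=1..n. norm (b j) * norm u)"
  proof (rule sum_norm_le)
    fix j assume "j \<in> {1..n}"
    then have "norm (b j) * norm (u ^ j) \<le> norm (b j) * norm u"
      by (intro mult_left_mono norm_power_le_norm assms(2)) auto
    then show "norm (b j * u ^ j) \<le> norm (b j) * norm u"
      using norm_mult_ineq order_trans by blast
  qed
  finally show ?thesis
    by (simp add: sum_distrib_right)
qed

text \<open>
  Evaluation sums up to the actual degree; padding with zero coefficients makes it agree with the
  sum over the given coefficients.
\<close>

lemma eval_poly_left_sum_monom: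
  fixes a :: "nat \<Rightarrow> 'a::semiring_1"
  shows "eval_poly_left (\<Sum>j\<le>n. monom (a j) j) u = (\<Sum>j\<le>n. a j * u ^ j)"
proof -
  let ?p = "\<Sum>j\<le>n. monom (a j) j"
  have coeff: "coeff ?p j = (if j \<le> n then a j else 0)" for j
    by (simp add: coeff_sum)
  then have "degree ?p \<le> n"
    by (intro degree_le) simp
  then have "eval_poly_left ?p u = (\<Sum>j\<le>n. coeff ?p j * u ^ j)"
    unfolding eval_poly_left_def
    by (intro sum.mono_neutral_left) (auto simp: coeff_eq_0)
  then show ?thesis
    by (simp add: coeff)
qed

theorem theorem2p12:
  fixes n :: nat
    and a :: "nat \<Rightarrow> 'a::{real_normed_algebra, ring_1, banach}"
    and p :: "'a poly"
    and u :: 'a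
  assumes "n \<ge> 1"
    and "invertible_elem (a 0)"
    and "invertible_elem (a n)"
    and "p = (\<Sum>j\<le>n. monom (a j) j)"
    and "eval_poly_left p u = 0"
    and "invertible_elem u"
  shows "norm u \<ge> 1 / max 1 (\<Sum>j=1..n. norm (inverse_elem (a 0) * a j))
    \<and> 1 / max 1 (\<Sum>j=1..n. norm (inverse_elem (a 0) * a j))
        \<ge> 1 / max 1 (norm (inverse_elem (a 0)) * (\<Sum>j=1..n. norm (a j)))"
proof -
  define c where "c = inverse_elem (a 0)"
  define S where "S = (\<Sum>j=1..n. norm (c * a j))"
  have "c * a 0 = 1"
    using is_inverse_of_inverse_elem [OF assms(2)] by (simp add: is_inverse_of_def c_def)
  moreover have "c * (\<Sum>j\<le>n. a j * u ^ j) = 0"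
    using assms(4,5) by (simp add: eval_poly_left_sum_monom)
  ultimately have unit: "1 + (\<Sum>j=1..n. (c * a j) * u ^ j) = 0"
    by (simp add: atMost_atLeast0 sum.atLeast_Suc_atMost distrib_left sum_distrib_left mult.assoc)
  have "1 \<le> max 1 S * norm u"
  proof (cases "norm u \<le> 1")
    case True
    then have "1 \<le> S * norm u"
      unfolding S_def by (rule sum_norm_bound_of_unit_combination [OF unit])
    also have "\<dots> \<le> max 1 S * norm u"
      by (intro mult_right_mono) auto
    finally show ?thesis .
  next
    case False
    then show ?thesis
      using mult_mono [of 1 "max 1 S" 1 "norm u"] by simp
  qed
  then have lower: "1 / max 1 S \<le> norm u"
    by (simp add: divide_le_eq mult.commute)
  have "S \<le> norm c * (\<Sum>j=1..n. norm (a j))"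
    unfolding S_def sum_distrib_left by (intro sum_mono norm_mult_ineq)
  then have "1 / max 1 (norm c * (\<Sum>j=1..n. norm (a j))) \<le> 1 / max 1 S"
    by (intro divide_left_mono) auto
  with lower show ?thesis
    by (simp add: S_def c_def)
qed

end
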